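(* There exists a real Banach space $X$ with a point $x \in S_X$ such that $\delta c(x)=2$ and $dc(x)=0$.
   Context: All Banach spaces are real. $B_X$, $S_X$, $X^*$ denote the closed unit ball, unit sphere and topological dual of a Banach space $X$. A slice of $B_X$ is a set $S(x^*,\delta)=\{y\in B_X : x^*(y)>1-\delta\}$ with $x^*\in S_{X^*}$ and $\delta>0$. For $x\in B_X$: The Daugavet constant $dc(x)$ is the supremum of all $\alpha\ge 0$ such that for all $\varepsilon,\delta>0$ and all $y^*\in S_{X^*}$ there exists $y\in S(y^*,\delta)$ with $\|y-x\|>\alpha-\varepsilon$. The $\Delta$-constant $\delta c(x)$ is the supremum of all $\alpha\ge 0$ such that for all $\varepsilon,\delta>0$ and all $y^*\in S_{X^*}$ with $x\in S(y^*,\delta)$ there exists $y\in S(y^*,\delta)$ with $\|y-x\|>\alpha-\varepsilon$. *)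

theory Defs
  imports "HOL-Algebra.Module" "HOL-Analysis.Analysis"
begin

text \<open>
  HOL cannot quantify existentially over types, so a Banach space is a structure on a carrier set:
  a module over the ring of real numbers (the multiplication and unit fields of the module record
  are not used) together with a norm, which matters only on the carrier.

  Existence is asserted with carriers inside \<open>nat \<Rightarrow> real\<close>.  This type has the cardinality of the
  continuum, so up to isometry it contains every separable Banach space.  Nothing is lost by this: a
  point \<open>x\<close> as asserted in some Banach space \<open>X\<close> also gives one in a separable closed subspace \<open>Y\<close> of
  \<open>X\<close>.  Let \<open>Y\<close> contain \<open>x\<close>, norming sequences for countably many functionals witnessing that the
  Daugavet constant is \<open>0\<close>, and, for every \<open>\<epsilon> > 0\<close>, countably many points of the unit ball at distance
  at least \<open>2 - \<epsilon>\<close> from \<open>x\<close> whose closed convex hull contains \<open>x\<close>.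
\<close>

definition real_ring :: "real ring" where
  "real_ring = \<lparr>carrier = UNIV, monoid.mult = (*), one = 1, zero = 0, add = (+)\<rparr>"

locale normed_module = Module.module real_ring V
  for V :: "(real, 'a) module" (structure) +
  fixes N :: "'a \<Rightarrow> real"
  assumes norm_eq_zero_iff: "x \<in> carrier V \<Longrightarrow> N x = 0 \<longleftrightarrow> x = \<zero>\<^bsub>V\<^esub>"
    and norm_triangle: "\<lbrakk>x \<in> carrier V; y \<in> carrier V\<rbrakk> \<Longrightarrow> N (x \<oplus>\<^bsub>V\<^esub> y) \<le> N x + N y"
    and norm_smult: "x \<in> carrier V \<Longrightarrow> N (a \<odot>\<^bsub>V\<^esub> x) = \<bar>a\<bar> * N x"

text \<open>
  The value \<open>0\<close> outside the carrier is there because \<^locale>\<open>Metric_space\<close> requires symmetry and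
  nonnegativity on the whole type.
\<close>

definition norm_dist :: "(real, 'a) module \<Rightarrow> ('a \<Rightarrow> real) \<Rightarrow> 'a \<Rightarrow> 'a \<Rightarrow> real" where
  "norm_dist V N x y = (if x \<in> carrier V \<and> y \<in> carrier V then N (x \<ominus>\<^bsub>V\<^esub> y) else 0)"

lemma (in normed_module) Metric_space_norm_dist: "Metric_space (carrier V) (norm_dist V N)"
proof -
  have R: "carrier real_ring = UNIV" "\<one>\<^bsub>real_ring\<^esub> = (1 :: real)"
    by (simp_all add: real_ring_def)
  have neg_one: "\<ominus>\<^bsub>real_ring\<^esub> 1 = - 1"
    by (rule R.minus_equality) (simp_all add: real_ring_def)
  have N_neg: "N (\<ominus> x) = N x" if "x \<in> carrier V" for x
    using smult_l_minus[of 1 x] smult_one[OF that] norm_smult[OF that, of "- 1"] that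
    by (simp add: R neg_one)
  have N_commute: "N (x \<ominus> y) = N (y \<ominus> x)" if "x \<in> carrier V" "y \<in> carrier V" for x y
    using N_neg[of "x \<ominus> y"] that by (simp add: a_minus_def M.minus_add M.a_comm)
  have N_nonneg: "0 \<le> N x" if "x \<in> carrier V" for x
    using norm_triangle[of x "\<ominus> x"] norm_eq_zero_iff[of "\<zero>"] N_neg[of x] that
    by (simp add: M.r_neg)
  have N_triangle: "N (x \<ominus> z) \<le> N (x \<ominus> y) + N (y \<ominus> z)"
    if "x \<in> carrier V" "y \<in> carrier V" "z \<in> carrier V" for x y z
  proof -
    have "(x \<ominus> y) \<oplus> (y \<ominus> z) = x \<ominus> z"
      using that by (simp add: a_minus_def M.a_assoc M.r_neg1)
    then show ?thesis
      using norm_triangle[of "x \<ominus> y" "y \<ominus> z"] that by simp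
  qed
  show ?thesis
  proof
    have "(x \<ominus> y) \<oplus> y = x" if "x \<in> carrier V" "y \<in> carrier V" for x y
      using that by (simp add: a_minus_def M.a_assoc M.l_neg)
    then have "x \<ominus> y = \<zero> \<longleftrightarrow> x = y" if "x \<in> carrier V" "y \<in> carrier V" for x y
      using that by (metis M.l_zero M.r_neg a_minus_def)
    then show "norm_dist V N x y = 0 \<longleftrightarrow> x = y" if "x \<in> carrier V" "y \<in> carrier V" for x y
      using that norm_eq_zero_iff[of "x \<ominus> y"] by (simp add: norm_dist_def)
  qed (auto simp: norm_dist_def N_nonneg intro: N_commute N_triangle)
qed

locale banach_module = normed_module +
  assumes complete: "Metric_space.mcomplete (carrier V) (norm_dist V N)"

definition unit_ball :: "(real, 'a) module \<Rightarrow> ('a \<Rightarrow> real) \<Rightarrow> 'a set" where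
  "unit_ball V N = {x \<in> carrier V. N x \<le> 1}"

definition unit_sphere :: "(real, 'a) module \<Rightarrow> ('a \<Rightarrow> real) \<Rightarrow> 'a set" where
  "unit_sphere V N = {x \<in> carrier V. N x = 1}"

text \<open>The values of a functional outside the carrier are irrelevant.\<close>

definition dual :: "(real, 'a) module \<Rightarrow> ('a \<Rightarrow> real) \<Rightarrow> ('a \<Rightarrow> real) set" where
  "dual V N = {f.
     (\<forall>x\<in>carrier V. \<forall>y\<in>carrier V. f (x \<oplus>\<^bsub>V\<^esub> y) = f x + f y) \<and>
     (\<forall>a. \<forall>x\<in>carrier V. f (a \<odot>\<^bsub>V\<^esub> x) = a * f x) \<and>
     (\<exists>C. \<forall>x\<in>carrier V. \<bar>f x\<bar> \<le> C * N x)}"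

definition dual_norm :: "(real, 'a) module \<Rightarrow> ('a \<Rightarrow> real) \<Rightarrow> ('a \<Rightarrow> real) \<Rightarrow> real" where
  "dual_norm V N f = (SUP x\<in>unit_ball V N. \<bar>f x\<bar>)"

definition dual_sphere :: "(real, 'a) module \<Rightarrow> ('a \<Rightarrow> real) \<Rightarrow> ('a \<Rightarrow> real) set" where
  "dual_sphere V N = {f \<in> dual V N. dual_norm V N f = 1}"

definition slice :: "(real, 'a) module \<Rightarrow> ('a \<Rightarrow> real) \<Rightarrow> ('a \<Rightarrow> real) \<Rightarrow> real \<Rightarrow> 'a set" where
  "slice V N f \<delta> = {y \<in> unit_ball V N. f y > 1 - \<delta>}"

text \<open>
  For \<open>x\<close> in the unit ball of a nonzero space the sets below contain \<open>0\<close> and are bounded by \<open>2\<close>, so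
  the real suprema are genuine.
\<close>

definition daugavet_const :: "(real, 'a) module \<Rightarrow> ('a \<Rightarrow> real) \<Rightarrow> 'a \<Rightarrow> real" where
  "daugavet_const V N x = Sup {\<alpha>. \<alpha> \<ge> 0 \<and>
     (\<forall>\<epsilon>>0. \<forall>\<delta>>0. \<forall>f\<in>dual_sphere V N.
        \<exists>y\<in>slice V N f \<delta>. N (y \<ominus>\<^bsub>V\<^esub> x) > \<alpha> - \<epsilon>)}"

definition delta_const :: "(real, 'a) module \<Rightarrow> ('a \<Rightarrow> real) \<Rightarrow> 'a \<Rightarrow> real" where
  "delta_const V N x = Sup {\<alpha>. \<alpha> \<ge> 0 \<and>
     (\<forall>\<epsilon>>0. \<forall>\<delta>>0. \<forall>f\<in>dual_sphere V N. x \<in> slice V N f \<delta> \<longrightarrow>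
        (\<exists>y\<in>slice V N f \<delta>. N (y \<ominus>\<^bsub>V\<^esub> x) > \<alpha> - \<epsilon>))}"

text \<open>Adequacy: every type of class \<^class>\<open>banach\<close> gives such a structure.\<close>

definition type_module :: "(real, 'a::real_normed_vector) module" where
  "type_module = \<lparr>carrier = UNIV, monoid.mult = undefined, one = undefined, zero = 0, add = (+),
     module.smult = scaleR\<rparr>"

lemma cring_real_ring: "cring real_ring"
proof (rule cringI)
  show "abelian_group real_ring"
    by (rule abelian_groupI) (auto simp: real_ring_def intro: exI[of _ "- x" for x :: real])
  show "comm_monoid real_ring"
    by (rule comm_monoidI) (auto simp: real_ring_def)
qed (simp add: real_ring_def algebra_simps)

lemma module_type_module: "Module.module real_ring (type_module :: (real, 'a::real_normed_vector) module)"
proof (rule moduleI)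
  show "abelian_group (type_module :: (real, 'a) module)"
    by (rule abelian_groupI)
       (auto simp: type_module_def algebra_simps intro: exI[of _ "- x" for x :: 'a])
qed (rule cring_real_ring, auto simp: real_ring_def type_module_def algebra_simps)

lemma minus_type_module: "x \<ominus>\<^bsub>type_module\<^esub> y = x - (y :: 'a::real_normed_vector)"
proof -
  interpret Module.module real_ring "type_module :: (real, 'a) module"
    by (rule module_type_module)
  have "\<ominus>\<^bsub>type_module\<^esub> y = - y"
    using M.minus_equality[of "- y" y] by (simp add: type_module_def)
  then show ?thesis
    by (simp add: a_minus_def) (simp add: type_module_def)
qed

lemma banach_module_type_module: "banach_module (type_module :: (real, 'a::banach) module) norm"
proof -
  interpret Module.module real_ring "type_module :: (real, 'a) module"
    by (rule module_type_module)
  have "norm_dist (type_module :: (real, 'a) module) norm = dist"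
    by (intro ext) (simp add: norm_dist_def minus_type_module dist_norm, simp add: type_module_def)
  moreover have "carrier (type_module :: (real, 'a) module) = UNIV"
    by (simp add: type_module_def)
  moreover have "Met_TC.mcomplete TYPE('a)"
    by (simp add: mcomplete_iff_complete complete_UNIV)
  ultimately show ?thesis
    by unfold_locales (auto simp: type_module_def norm_triangle_ineq)
qed

lemma dual_type_module: "dual (type_module :: (real, 'a::real_normed_vector) module) norm = {f. bounded_linear f}"
proof (intro Set.set_eqI iffI)
  fix f :: "'a \<Rightarrow> real"
  assume "f \<in> dual type_module norm"
  then obtain C where "f (x + y) = f x + f y" "f (a *\<^sub>R x) = a * f x" "\<bar>f x\<bar> \<le> C * norm x" for x y a
    by (auto simp: dual_def type_module_def)
  then show "f \<in> {f. bounded_linear f}"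
    by (auto intro!: bounded_linear_intro[where K = C] simp: mult.commute)
next
  fix f :: "'a \<Rightarrow> real"
  assume "f \<in> {f. bounded_linear f}"
  then interpret bounded_linear f by simp
  show "f \<in> dual type_module norm"
    using bounded by (auto simp: dual_def type_module_def add scaleR mult.commute)
qed

end

theory Submission
  imports Defs
begin

text \<open>
  Adjoin a line \<open>\<real>e\<close> to \<open>\<ell>\<^sub>\<infinity>\<close> and take as unit ball the convex hull of the ball of \<open>\<ell>\<^sub>\<infinity>\<close> and
  the Euclidean disc in the plane spanned by \<open>x = (1, 1, \<dots>)\<close> and \<open>e\<close>.  The projection onto \<open>\<ell>\<^sub>\<infinity>\<close>
  maps this ball onto the ball of \<open>\<ell>\<^sub>\<infinity>\<close>, so \<open>\<ell>\<^sub>\<infinity>\<close> keeps its norm.  The points \<open>x - 2 e\<^sub>k\<close> of the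
  ball are at distance \<open>2\<close> from \<open>x\<close> and their averages converge to \<open>x\<close>, so every slice that
  contains \<open>x\<close> contains one of them.  On the other hand, for \<open>c\<^sup>2 + s\<^sup>2 = 1\<close> with \<open>0 < c < 1\<close> the
  point \<open>c x + s e\<close> of the disc is strongly exposed by \<open>v \<mapsto> c v\<^sub>1 + s v\<^sub>e\<close>, and it tends to \<open>x\<close> as
  \<open>c \<rightarrow> 1\<close>.
\<close>

text \<open>Coordinate \<open>0\<close> of a sequence is the coefficient of \<open>e\<close>; the others form the point of \<open>\<ell>\<^sub>\<infinity>\<close>.\<close>

definition disc_module :: "(real, nat \<Rightarrow> real) module" where
  "disc_module = \<lparr>carrier = {v. bounded (range v)}, monoid.mult = undefined, one = undefined,
     zero = (\<lambda>_. 0), add = (\<lambda>v w i. v i + w i), module.smult = (\<lambda>a v i. a * v i)\<rparr>"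

text \<open>The gauge of the convex hull: \<open>v\<close> splits into a sequence with coordinate
  \<open>0\<close> equal to zero and sup norm at most \<open>u\<close>, and the point
  \<open>a x + (v 0) e\<close> of the plane, measured by its Euclidean norm. A bound
  \<open>u\<close> replaces the sup norm, so that no supremum occurs.\<close>

definition disc_norm :: "(nat \<Rightarrow> real) \<Rightarrow> real" where
  "disc_norm v = Inf {u + sqrt (a\<^sup>2 + (v 0)\<^sup>2) | a u. \<forall>i. \<bar>v (Suc i) - a\<bar> \<le> u}"

definition disc_point :: "real \<Rightarrow> real \<Rightarrow> nat \<Rightarrow> real" where
  "disc_point c s i = (if i = 0 then s else c)"

text \<open>The inner product with \<open>(c, s)\<close> on the plane, extended to the whole space
  by reading the component along \<open>x\<close> off coordinate \<open>1\<close>.\<close>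

definition disc_functional :: "real \<Rightarrow> real \<Rightarrow> (nat \<Rightarrow> real) \<Rightarrow> real" where
  "disc_functional c s v = c * v 1 + s * v 0"

section \<open>The vector space\<close>

lemma disc_module_simps [simp]:
  "v \<in> carrier disc_module \<longleftrightarrow> bounded (range v)"
  "\<zero>\<^bsub>disc_module\<^esub> = (\<lambda>_. 0)"
  "v \<oplus>\<^bsub>disc_module\<^esub> w = (\<lambda>i. v i + w i)"
  "a \<odot>\<^bsub>disc_module\<^esub> v = (\<lambda>i. a * v i)"
  by (simp_all add: disc_module_def)

lemma bounded_range_cmult: "bounded (range (\<lambda>i. a * v i))" if "bounded (range v)" for a :: real
  using bounded_scaleR_comp[OF that, of a] by simp

lemma module_disc_module: "Module.module real_ring disc_module"
proof (rule moduleI)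
  show "abelian_group disc_module"
  proof (rule abelian_groupI)
    fix v assume "v \<in> carrier disc_module"
    then show "\<exists>w\<in>carrier disc_module. w \<oplus>\<^bsub>disc_module\<^esub> v = \<zero>\<^bsub>disc_module\<^esub>"
      using bounded_range_cmult[of v "- 1"] by (intro bexI[of _ "\<lambda>i. - v i"]) auto
  qed (auto simp: bounded_plus_comp algebra_simps)
qed (rule cring_real_ring, auto simp: real_ring_def bounded_range_cmult algebra_simps)

lemma minus_disc_module:
  assumes "bounded (range w)"
  shows "v \<ominus>\<^bsub>disc_module\<^esub> w = (\<lambda>i. v i - w i)"
proof -
  interpret Module.module real_ring disc_module
    by (rule module_disc_module)
  have "\<ominus>\<^bsub>disc_module\<^esub> w = (\<lambda>i. - w i)"
    using bounded_range_cmult[OF assms, of "- 1"] assms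
    by (intro M.minus_equality) auto
  then show ?thesis
    by (simp add: a_minus_def)
qed

section \<open>The norm and its comparison with the sup norm\<close>

lemma abs_diff_bound_nonneg: "0 \<le> u" if "\<forall>i. \<bar>v (Suc i) - a\<bar> \<le> u" for a u :: real
  using that[rule_format, of 0] by linarith

lemma disc_norm_le:
  assumes "\<And>i. \<bar>v (Suc i) - a\<bar> \<le> u"
  shows "disc_norm v \<le> u + sqrt (a\<^sup>2 + (v 0)\<^sup>2)"
  unfolding disc_norm_def using assms
  by (intro cInf_lower bdd_belowI[of _ 0]) (auto dest: abs_diff_bound_nonneg)

lemma disc_norm_decomp_set_ne:
  assumes "bounded (range v)"
  shows "{u + sqrt (a\<^sup>2 + (v 0)\<^sup>2) | a u. \<forall>i. \<bar>v (Suc i) - a\<bar> \<le> u} \<noteq> {}"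
proof -
  obtain B where "\<And>i. \<bar>v i\<bar> \<le> B"
    using assms by (auto simp: bounded_iff)
  then have "\<forall>i. \<bar>v (Suc i) - 0\<bar> \<le> B"
    by simp
  then show ?thesis
    by blast
qed

lemma disc_norm_ge:
  assumes "bounded (range v)"
    and "\<And>a u. (\<And>i. \<bar>v (Suc i) - a\<bar> \<le> u) \<Longrightarrow> b \<le> u + sqrt (a\<^sup>2 + (v 0)\<^sup>2)"
  shows "b \<le> disc_norm v"
  unfolding disc_norm_def
  using disc_norm_decomp_set_ne[OF assms(1)] assms(2) by (intro cInf_greatest) auto

lemma disc_norm_decomp:
  assumes "bounded (range v)" "disc_norm v < b"
  obtains a u where "\<And>i. \<bar>v (Suc i) - a\<bar> \<le> u" "u + sqrt (a\<^sup>2 + (v 0)\<^sup>2) < b"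
  using cInf_lessD[OF disc_norm_decomp_set_ne[OF assms(1)] assms(2)[unfolded disc_norm_def]]
  by auto

text \<open>In every decomposition the Euclidean part dominates both \<open>\<bar>v 0\<bar>\<close>
  and \<open>\<bar>a\<bar>\<close>, and the other coordinates differ from \<open>a\<close> by at
  most \<open>u\<close>. With the next lemma this makes the norm equivalent to the sup norm.\<close>

lemma abs_le_disc_norm:
  assumes "bounded (range v)"
  shows "\<bar>v i\<bar> \<le> disc_norm v"
proof (rule disc_norm_ge[OF assms])
  fix a u assume u: "\<And>i. \<bar>v (Suc i) - a\<bar> \<le> u"
  then have "0 \<le> u"
    by (intro abs_diff_bound_nonneg) auto
  have "\<bar>a\<bar> \<le> sqrt (a\<^sup>2 + (v 0)\<^sup>2)" "\<bar>v 0\<bar> \<le> sqrt (a\<^sup>2 + (v 0)\<^sup>2)"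
    by (rule real_sqrt_ge_abs1 real_sqrt_ge_abs2)+
  show "\<bar>v i\<bar> \<le> u + sqrt (a\<^sup>2 + (v 0)\<^sup>2)"
  proof (cases i)
    case 0
    then show ?thesis
      using \<open>0 \<le> u\<close> \<open>\<bar>v 0\<bar> \<le> _\<close> unfolding 0 by linarith
  next
    case (Suc j)
    then show ?thesis
      using u[of j] \<open>\<bar>a\<bar> \<le> _\<close> unfolding Suc by linarith
  qed
qed

lemma disc_norm_le_sup:
  assumes "\<And>i. \<bar>v i\<bar> \<le> b"
  shows "disc_norm v \<le> b + b"
proof -
  have "disc_norm v \<le> b + sqrt (0\<^sup>2 + (v 0)\<^sup>2)"
    using assms by (intro disc_norm_le) simp
  then show ?thesis
    using assms[of 0] by simp
qed

text \<open>Nearly optimal decompositions of the summands add up to a decomposition of the sum; the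
  disc parts obey the triangle inequality of the plane.\<close>

lemma disc_norm_add_le:
  assumes v: "bounded (range v)" and w: "bounded (range w)"
  shows "disc_norm (\<lambda>i. v i + w i) \<le> disc_norm v + disc_norm w"
proof (rule field_le_epsilon)
  fix e :: real assume "e > 0"
  obtain a u where a: "\<And>i. \<bar>v (Suc i) - a\<bar> \<le> u" "u + sqrt (a\<^sup>2 + (v 0)\<^sup>2) < disc_norm v + e/2"
    using disc_norm_decomp[OF v, of "disc_norm v + e/2"] \<open>e > 0\<close> by auto
  obtain b t where b: "\<And>i. \<bar>w (Suc i) - b\<bar> \<le> t" "t + sqrt (b\<^sup>2 + (w 0)\<^sup>2) < disc_norm w + e/2"
    using disc_norm_decomp[OF w, of "disc_norm w + e/2"] \<open>e > 0\<close> by auto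
  have "\<bar>(v (Suc i) + w (Suc i)) - (a + b)\<bar> \<le> u + t" for i
    using a(1)[of i] b(1)[of i] by linarith
  then have "disc_norm (\<lambda>i. v i + w i) \<le> u + t + sqrt ((a + b)\<^sup>2 + (v 0 + w 0)\<^sup>2)"
    by (rule disc_norm_le)
  also have "sqrt ((a + b)\<^sup>2 + (v 0 + w 0)\<^sup>2) \<le> sqrt (a\<^sup>2 + (v 0)\<^sup>2) + sqrt (b\<^sup>2 + (w 0)\<^sup>2)"
    by (rule real_sqrt_sum_squares_triangle_ineq)
  finally show "disc_norm (\<lambda>i. v i + w i) \<le> disc_norm v + disc_norm w + e"
    using a(2) b(2) by linarith
qed

lemma disc_norm_cmult_le:
  assumes v: "bounded (range v)"
  shows "disc_norm (\<lambda>i. c * v i) \<le> \<bar>c\<bar> * disc_norm v"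
proof (cases "c = 0")
  case True
  then show ?thesis
    using disc_norm_le[of "\<lambda>_. 0" 0 0] by simp
next
  case False
  have "disc_norm (\<lambda>i. c * v i) / \<bar>c\<bar> \<le> disc_norm v"
  proof (rule disc_norm_ge[OF v])
    fix a u assume "\<And>i. \<bar>v (Suc i) - a\<bar> \<le> u"
    then have "\<bar>c * v (Suc i) - c * a\<bar> \<le> \<bar>c\<bar> * u" for i
      by (simp add: abs_mult mult_left_mono flip: right_diff_distrib)
    then have "disc_norm (\<lambda>i. c * v i) \<le> \<bar>c\<bar> * u + sqrt ((c * a)\<^sup>2 + (c * v 0)\<^sup>2)"
      by (rule disc_norm_le)
    also have "(c * a)\<^sup>2 + (c * v 0)\<^sup>2 = c\<^sup>2 * (a\<^sup>2 + (v 0)\<^sup>2)"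
      by (simp add: power_mult_distrib algebra_simps)
    also have "sqrt \<dots> = \<bar>c\<bar> * sqrt (a\<^sup>2 + (v 0)\<^sup>2)"
      by (simp add: real_sqrt_mult)
    finally show "disc_norm (\<lambda>i. c * v i) / \<bar>c\<bar> \<le> u + sqrt (a\<^sup>2 + (v 0)\<^sup>2)"
      using False by (simp add: divide_le_eq distrib_left mult.commute)
  qed
  then show ?thesis
    using False by (simp add: divide_le_eq mult.commute)
qed

text \<open>For \<open>c \<noteq> 0\<close> the reverse inequality is the previous lemma with factor
  \<open>inverse c\<close>, applied to the multiple of \<open>v\<close> by \<open>c\<close>.\<close>

lemma disc_norm_cmult:
  assumes v: "bounded (range v)"
  shows "disc_norm (\<lambda>i. c * v i) = \<bar>c\<bar> * disc_norm v"
proof (cases "c = 0")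
  case True
  then show ?thesis
    using disc_norm_cmult_le[OF v, of c] abs_le_disc_norm[of "\<lambda>_. 0" 0]
    by (simp add: image_constant_conv)
next
  case False
  have "disc_norm v \<le> \<bar>inverse c\<bar> * disc_norm (\<lambda>i. c * v i)"
    using disc_norm_cmult_le[OF bounded_range_cmult[OF v, of c], of "inverse c"] False
    by (simp flip: mult.assoc)
  then have "\<bar>c\<bar> * disc_norm v \<le> disc_norm (\<lambda>i. c * v i)"
    using False by (simp add: abs_inverse field_simps)
  then show ?thesis
    using disc_norm_cmult_le[OF v, of c] by linarith
qed

lemma normed_module_disc: "normed_module disc_module disc_norm"
proof -
  interpret Module.module real_ring disc_module
    by (rule module_disc_module)
  show ?thesis
  proof unfold_locales
    fix v assume v: "v \<in> carrier disc_module"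
    show "disc_norm v = 0 \<longleftrightarrow> v = \<zero>\<^bsub>disc_module\<^esub>"
    proof
      assume "disc_norm v = 0"
      then show "v = \<zero>\<^bsub>disc_module\<^esub>"
        using v abs_le_disc_norm[of v] by (auto intro!: ext)
    next
      assume "v = \<zero>\<^bsub>disc_module\<^esub>"
      then show "disc_norm v = 0"
        using v disc_norm_cmult[of v 0] by simp
    qed
  qed (auto simp: disc_norm_add_le disc_norm_cmult)
qed

section \<open>Completeness\<close>

lemma banach_module_disc: "banach_module disc_module disc_norm"
proof -
  interpret normed_module disc_module disc_norm
    by (rule normed_module_disc)
  interpret D: Metric_space "carrier disc_module" "norm_dist disc_module disc_norm"
    by (rule Metric_space_norm_dist)
  have dist: "norm_dist disc_module disc_norm v w = disc_norm (\<lambda>i. v i - w i)"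
    if "bounded (range v)" "bounded (range w)" for v w
    using that by (simp add: norm_dist_def minus_disc_module)
  have "D.mcomplete"
    unfolding D.mcomplete_def
  proof (intro allI impI)
    fix \<sigma> assume "D.MCauchy \<sigma>"
    then have bdd: "bounded (range (\<sigma> n))" for n
      unfolding D.MCauchy_def by (metis disc_module_simps(1) range_subsetD)
    have cauchy: "\<exists>M. \<forall>m\<ge>M. \<forall>n\<ge>M. \<forall>i. \<bar>\<sigma> m i - \<sigma> n i\<bar> < e" if "e > 0" for e
    proof -
      obtain M where M: "\<And>m n. m \<ge> M \<Longrightarrow> n \<ge> M \<Longrightarrow> disc_norm (\<lambda>i. \<sigma> m i - \<sigma> n i) < e"
        using \<open>D.MCauchy \<sigma>\<close> \<open>e > 0\<close> unfolding D.MCauchy_def by (metis dist bdd)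
      show ?thesis
        using abs_le_disc_norm[OF bounded_minus_comp[OF bdd bdd]] M
        by (meson le_less_trans)
    qed
    have "Cauchy (\<lambda>n. \<sigma> n i)" for i
      using cauchy by (fastforce simp: Cauchy_def dist_real_def)
    then have "\<forall>i. \<exists>l. (\<lambda>n. \<sigma> n i) \<longlonglongrightarrow> l"
      by (simp add: Cauchy_convergent_iff convergent_def)
    then obtain l where l: "\<And>i. (\<lambda>n. \<sigma> n i) \<longlonglongrightarrow> l i"
      by metis
    \<comment> \<open>Letting \<open>n\<close> grow in the uniform Cauchy estimate gives convergence
      uniform in the coordinate.\<close>
    have close: "\<exists>M. \<forall>m\<ge>M. \<forall>i. \<bar>\<sigma> m i - l i\<bar> \<le> e" if "e > 0" for e
    proof -
      obtain M where M: "\<And>m n i. m \<ge> M \<Longrightarrow> n \<ge> M \<Longrightarrow> \<bar>\<sigma> m i - \<sigma> n i\<bar> < e"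
        using cauchy[OF \<open>e > 0\<close>] by blast
      have "\<bar>\<sigma> m i - l i\<bar> \<le> e" if "m \<ge> M" for m i
      proof (rule LIMSEQ_le_const2)
        show "(\<lambda>n. \<bar>\<sigma> m i - \<sigma> n i\<bar>) \<longlonglongrightarrow> \<bar>\<sigma> m i - l i\<bar>"
          by (intro tendsto_intros l)
        show "\<exists>N. \<forall>n\<ge>N. \<bar>\<sigma> m i - \<sigma> n i\<bar> \<le> e"
          using M[OF that] less_imp_le by blast
      qed
      then show ?thesis
        by blast
    qed
    obtain M where "\<And>i. \<bar>\<sigma> M i - l i\<bar> \<le> 1"
      using close[of 1] by auto
    then have "bounded (range (\<lambda>i. \<sigma> M i - l i))"
      by (auto simp: bounded_iff)
    then have l_bdd: "bounded (range l)"
      using bounded_minus_comp[OF bdd[of M]] by fastforce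
    show "\<exists>l. limitin D.mtopology \<sigma> l sequentially"
      unfolding D.limitin_metric eventually_sequentially
    proof (rule exI[of _ l], intro conjI allI impI)
      show "l \<in> carrier disc_module"
        using l_bdd by simp
      fix e :: real assume "e > 0"
      \<comment> \<open>Passing from the sup norm to \<open>disc_norm\<close> costs a factor of 2,
        and \<open>2 * e/3 < e\<close>.\<close>
      then obtain M where M: "\<And>m i. m \<ge> M \<Longrightarrow> \<bar>\<sigma> m i - l i\<bar> \<le> e/3"
        using close[of "e/3"] by auto
      have "disc_norm (\<lambda>i. \<sigma> m i - l i) < e" if "m \<ge> M" for m
        using disc_norm_le_sup[of "\<lambda>i. \<sigma> m i - l i", OF M[OF that]] \<open>e > 0\<close> by linarith
      then show "\<exists>M. \<forall>m\<ge>M. \<sigma> m \<in> carrier disc_module \<and> norm_dist disc_module disc_norm (\<sigma> m) l < e"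
        using bdd l_bdd dist by auto
    qed
  qed
  then show ?thesis
    by unfold_locales
qed

section \<open>Points of the disc, their norming functionals, and slices\<close>

lemma bounded_range_disc_point [simp]: "bounded (range (disc_point c s))"
  by (auto simp: bounded_iff disc_point_def intro!: exI[of _ "max \<bar>c\<bar> \<bar>s\<bar>"])

lemma disc_norm_disc_point_le: "disc_norm (disc_point c s) \<le> sqrt (c\<^sup>2 + s\<^sup>2)"
  using disc_norm_le[of "disc_point c s" c 0] by (simp add: disc_point_def)

text \<open>Cauchy-Schwarz in the plane, from Lagrange's identity.\<close>

lemma inner_le_sqrt:
  fixes c s a b :: real
  assumes "c\<^sup>2 + s\<^sup>2 = 1"
  shows "\<bar>c * a + s * b\<bar> \<le> sqrt (a\<^sup>2 + b\<^sup>2)"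
proof (rule real_le_rsqrt)
  have "a\<^sup>2 + b\<^sup>2 = (c\<^sup>2 + s\<^sup>2) * (a\<^sup>2 + b\<^sup>2)"
    using assms by simp
  also have "\<dots> = (c * a + s * b)\<^sup>2 + (c * b - s * a)\<^sup>2"
    by (simp add: power2_eq_square algebra_simps)
  finally show "\<bar>c * a + s * b\<bar>\<^sup>2 \<le> a\<^sup>2 + b\<^sup>2"
    by simp
qed

text \<open>Along a decomposition the functional is \<open>c * (v 1 - a)\<close> plus an inner
  product with the unit vector \<open>(c, s)\<close>. The first is at most \<open>u\<close> because
  \<open>c \<le> 1\<close>, the second at most the Euclidean part.\<close>

lemma disc_functional_le:
  assumes "c\<^sup>2 + s\<^sup>2 = 1" "0 \<le> c" "bounded (range v)"
  shows "\<bar>disc_functional c s v\<bar> \<le> disc_norm v"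
proof (rule disc_norm_ge[OF assms(3)])
  fix a u assume u: "\<And>i. \<bar>v (Suc i) - a\<bar> \<le> u"
  have "c \<le> 1"
    using le_add_same_cancel1[of "c\<^sup>2" "s\<^sup>2"] assms(1) by (intro power2_le_imp_le[of c 1]) simp_all
  have "\<bar>c * (v 1 - a)\<bar> \<le> 1 * u"
    unfolding abs_mult using u[of 0] \<open>c \<le> 1\<close> \<open>0 \<le> c\<close> by (intro mult_mono) auto
  moreover have "disc_functional c s v = c * (v 1 - a) + (c * a + s * v 0)"
    by (simp add: disc_functional_def algebra_simps)
  ultimately show "\<bar>disc_functional c s v\<bar> \<le> u + sqrt (a\<^sup>2 + (v 0)\<^sup>2)"
    using inner_le_sqrt[OF assms(1), of a "v 0"] by linarith
qed

lemma disc_functional_disc_point: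
  "c\<^sup>2 + s\<^sup>2 = 1 \<Longrightarrow> disc_functional c s (disc_point c s) = 1"
  by (simp add: disc_functional_def disc_point_def power2_eq_square)

text \<open>The norm 1 is attained at \<open>disc_point c s\<close>.\<close>

lemma disc_functional_in_dual_sphere:
  assumes "c\<^sup>2 + s\<^sup>2 = 1" "0 \<le> c"
  shows "disc_functional c s \<in> dual_sphere disc_module disc_norm"
proof -
  have "disc_functional c s \<in> dual disc_module disc_norm"
    using disc_functional_le[OF assms]
    by (auto simp: dual_def disc_functional_def algebra_simps intro!: exI[of _ 1])
  moreover have "dual_norm disc_module disc_norm (disc_functional c s) = 1"
    unfolding dual_norm_def
  proof (rule cSup_eq_maximum)
    have "disc_point c s \<in> unit_ball disc_module disc_norm"
      using disc_norm_disc_point_le[of c s] assms(1) by (simp add: unit_ball_def)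
    moreover have "\<bar>disc_functional c s (disc_point c s)\<bar> = 1"
      using disc_functional_disc_point[OF assms(1)] by simp
    ultimately show "1 \<in> (\<lambda>v. \<bar>disc_functional c s v\<bar>) ` unit_ball disc_module disc_norm"
      by (metis imageI)
  qed (use disc_functional_le[OF assms] in \<open>fastforce simp: unit_ball_def\<close>)
  ultimately show ?thesis
    by (simp add: dual_sphere_def)
qed

lemma disc_point_in_unit_sphere: "disc_point 1 0 \<in> unit_sphere disc_module disc_norm"
proof -
  have "disc_point 1 0 1 = 1"
    by (simp add: disc_point_def)
  then show ?thesis
    using disc_norm_disc_point_le[of 1 0] abs_le_disc_norm[of "disc_point 1 0" 1]
    by (simp add: unit_sphere_def)
qed

text \<open>The dual norm is a supremum of \<open>\<bar>f x\<bar>\<close>; multiplying a nearly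
  maximal \<open>x\<close> by the sign of \<open>f x\<close> moves it into the slice.\<close>

lemma (in normed_module) slice_nonempty:
  assumes f: "f \<in> dual_sphere V N" and "\<delta> > 0"
  shows "slice V N f \<delta> \<noteq> {}"
proof -
  have R: "a \<in> carrier real_ring" for a
    by (simp add: real_ring_def)
  have N0: "N \<zero> = 0"
    using norm_eq_zero_iff by simp
  then have "(\<lambda>x. \<bar>f x\<bar>) ` unit_ball V N \<noteq> {}"
    by (auto simp: unit_ball_def intro!: exI[of _ \<zero>])
  then have "\<exists>r\<in>(\<lambda>x. \<bar>f x\<bar>) ` unit_ball V N. 1 - \<delta> < r"
    using assms by (intro less_cSupD) (simp_all add: dual_sphere_def dual_norm_def)
  then obtain x where x: "x \<in> unit_ball V N" "1 - \<delta> < \<bar>f x\<bar>"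
    by auto
  define y where "y = sgn (f x) \<odot> x"
  have "x \<in> carrier V"
    using x by (simp add: unit_ball_def)
  have "N y \<le> 1"
    using x norm_smult[OF \<open>x \<in> carrier V\<close>, of "sgn (f x)"]
    by (simp add: y_def unit_ball_def abs_sgn_eq)
  moreover have "f y = \<bar>f x\<bar>"
    using f \<open>x \<in> carrier V\<close> by (simp add: dual_sphere_def dual_def y_def abs_sgn mult.commute)
  ultimately show ?thesis
    using x R \<open>x \<in> carrier V\<close> by (auto simp: slice_def unit_ball_def y_def)
qed

section \<open>The Delta-constant\<close>

text \<open>If every \<open>x\<close> with one entry flipped to \<open>-1\<close> lay outside the
  slice, \<open>f\<close> would be at least a fixed \<open>\<gamma> > 0\<close> on every unit
  vector. Then \<open>f\<close> would be at least \<open>n * \<gamma>\<close> on the indicator of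
  \<open>n\<close> coordinates, whose norm is at most 1, and so unbounded.\<close>

lemma far_point_in_slice:
  assumes f: "f \<in> dual_sphere disc_module disc_norm"
    and x: "disc_point 1 0 \<in> slice disc_module disc_norm f \<delta>"
  shows "\<exists>y\<in>slice disc_module disc_norm f \<delta>. 2 \<le> disc_norm (y \<ominus>\<^bsub>disc_module\<^esub> disc_point 1 0)"
proof (rule ccontr)
  assume no_far: "\<not> ?thesis"
  \<comment> \<open>\<open>E (Suc k) (Suc k)\<close> is a unit vector avoiding coordinate
    \<open>0\<close>, and \<open>E 1 n\<close> is the sum of the first \<open>n\<close> of
    these.\<close>
  define E :: "nat \<Rightarrow> nat \<Rightarrow> nat \<Rightarrow> real" where "E m n i = indicator {m..n} i" for m n i
  have bdd: "bounded (range (E m n))" for m n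
    by (auto simp: bounded_iff E_def indicator_def intro!: exI[of _ 1])
  have add: "f (\<lambda>i. v i + w i) = f v + f w" if "bounded (range v)" "bounded (range w)" for v w
    using f that by (simp add: dual_sphere_def dual_def)
  have cmult: "f (\<lambda>i. a * v i) = a * f v" if "bounded (range v)" for a v
    using f that by (simp add: dual_sphere_def dual_def)
  obtain C where C: "\<And>v. bounded (range v) \<Longrightarrow> \<bar>f v\<bar> \<le> C * disc_norm v"
    using f unfolding dual_sphere_def dual_def disc_module_simps(1)[symmetric] by blast
  \<comment> \<open>Half the margin by which \<open>x\<close> lies in the slice; the half undoes the
    factor 2 in \<open>x - 2 e\<^sub>k\<close>.\<close>
  define \<gamma> where "\<gamma> = (f (disc_point 1 0) - (1 - \<delta>)) / 2"
  have "\<gamma> > 0"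
    using x by (simp add: \<gamma>_def slice_def)
  have E_ge: "f (E (Suc k) (Suc k)) \<ge> \<gamma>" for k
  proof -
    define y where "y = (\<lambda>i. disc_point 1 0 i + - 2 * E (Suc k) (Suc k) i)"
    have y_bdd: "bounded (range y)"
      unfolding y_def by (intro bounded_plus_comp bounded_range_cmult bdd bounded_range_disc_point)
    \<comment> \<open>The decomposition with \<open>a = 0\<close>: all entries past coordinate
      \<open>0\<close> have absolute value 1.\<close>
    have "disc_norm y \<le> 1 + sqrt (0\<^sup>2 + (y 0)\<^sup>2)"
      by (rule disc_norm_le) (auto simp: y_def disc_point_def E_def indicator_def)
    also have "\<dots> = 1"
      by (simp add: y_def disc_point_def E_def)
    finally have "disc_norm y \<le> 1" .
    have "y \<ominus>\<^bsub>disc_module\<^esub> disc_point 1 0 = (\<lambda>i. - 2 * E (Suc k) (Suc k) i)"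
      by (simp add: minus_disc_module y_def)
    then have "2 \<le> disc_norm (y \<ominus>\<^bsub>disc_module\<^esub> disc_point 1 0)"
      using abs_le_disc_norm[OF bounded_range_cmult[OF bdd], of "- 2" "Suc k" "Suc k" "Suc k"]
      by (simp add: E_def)
    then have "y \<notin> slice disc_module disc_norm f \<delta>"
      using no_far by blast
    then have "f y \<le> 1 - \<delta>"
      using y_bdd \<open>disc_norm y \<le> 1\<close> by (simp add: slice_def unit_ball_def)
    moreover have "f y = f (disc_point 1 0) - 2 * f (E (Suc k) (Suc k))"
      unfolding y_def
      using add[OF bounded_range_disc_point bounded_range_cmult[OF bdd]] cmult[OF bdd, of "- 2"]
      by (metis add.commute mult_minus_left uminus_add_conv_diff)
    ultimately show ?thesis
      by (simp add: \<gamma>_def)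
  qed
  have sum_ge: "real n * \<gamma> \<le> f (E 1 n)" for n
  proof (induction n)
    case 0
    have "E 1 0 = (\<lambda>i. 0 * E 1 0 i)"
      by (auto simp: E_def)
    then have "f (E 1 0) = 0"
      using cmult[OF bdd, of 0 1 0] by simp
    then show ?case
      by simp
  next
    case (Suc n)
    have "E 1 (Suc n) = (\<lambda>i. E 1 n i + E (Suc n) (Suc n) i)"
      by (auto simp: fun_eq_iff E_def indicator_def)
    then have "f (E 1 (Suc n)) = f (E 1 n) + f (E (Suc n) (Suc n))"
      using add[OF bdd bdd] by simp
    then show ?case
      using Suc E_ge[of n] by (simp add: algebra_simps)
  qed
  have "real n * \<gamma> \<le> \<bar>C\<bar>" for n
  proof -
    have "disc_norm (E 1 n) \<le> 1"
      using disc_norm_le[of "E 1 n" 0 1] by (auto simp: E_def indicator_def)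
    moreover have "0 \<le> disc_norm (E 1 n)"
      using abs_le_disc_norm[OF bdd, of 1 n 0] by linarith
    \<comment> \<open>The sign of \<open>C\<close> is unknown, hence the absolute value.\<close>
    ultimately have "C * disc_norm (E 1 n) \<le> \<bar>C\<bar> * 1"
      by (intro mult_mono) auto
    then show ?thesis
      using sum_ge[of n] C[OF bdd, of 1 n] by linarith
  qed
  then show False
    using reals_Archimedean3[OF \<open>\<gamma> > 0\<close>] by (meson not_less)
qed

lemma delta_const_disc: "delta_const disc_module disc_norm (disc_point 1 0) = 2"
  unfolding delta_const_def
proof (rule cSup_eq_maximum)
  show "2 \<in> {\<alpha>. \<alpha> \<ge> 0 \<and> (\<forall>\<epsilon>>0. \<forall>\<delta>>0. \<forall>f\<in>dual_sphere disc_module disc_norm.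
    disc_point 1 0 \<in> slice disc_module disc_norm f \<delta> \<longrightarrow>
    (\<exists>y\<in>slice disc_module disc_norm f \<delta>. disc_norm (y \<ominus>\<^bsub>disc_module\<^esub> disc_point 1 0) > \<alpha> - \<epsilon>))}"
    using far_point_in_slice by (force intro: less_le_trans[of "2 - _" 2])
next
  fix \<alpha> assume "\<alpha> \<in> {\<alpha>. \<alpha> \<ge> 0 \<and> (\<forall>\<epsilon>>0. \<forall>\<delta>>0. \<forall>f\<in>dual_sphere disc_module disc_norm.
    disc_point 1 0 \<in> slice disc_module disc_norm f \<delta> \<longrightarrow>
    (\<exists>y\<in>slice disc_module disc_norm f \<delta>. disc_norm (y \<ominus>\<^bsub>disc_module\<^esub> disc_point 1 0) > \<alpha> - \<epsilon>))}"
  \<comment> \<open>The upper bound needs one slice that contains \<open>x\<close>; the triangle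
    inequality then bounds distances by 2.\<close>
  moreover have "disc_point 1 0 \<in> slice disc_module disc_norm (disc_functional 1 0) 1"
    using disc_point_in_unit_sphere disc_functional_disc_point[of 1 0]
    by (simp add: slice_def unit_ball_def unit_sphere_def)
  moreover have "disc_functional 1 0 \<in> dual_sphere disc_module disc_norm"
    by (rule disc_functional_in_dual_sphere) auto
  ultimately have far: "\<exists>y\<in>slice disc_module disc_norm (disc_functional 1 0) 1.
      disc_norm (y \<ominus>\<^bsub>disc_module\<^esub> disc_point 1 0) > \<alpha> - \<epsilon>" if "\<epsilon> > 0" for \<epsilon>
    using that zero_less_one by blast
  show "\<alpha> \<le> 2"
  proof (rule field_le_epsilon)
    fix \<epsilon> :: real assume "\<epsilon> > 0"
    then obtain y where y: "y \<in> slice disc_module disc_norm (disc_functional 1 0) 1"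
      "disc_norm (\<lambda>i. y i - disc_point 1 0 i) > \<alpha> - \<epsilon>"
      using far[of \<epsilon>] by (auto simp: minus_disc_module)
    then have "bounded (range y)" "disc_norm y \<le> 1"
      by (auto simp: slice_def unit_ball_def)
    moreover have "disc_norm (\<lambda>i. - 1 * disc_point 1 0 i) = 1"
      using disc_point_in_unit_sphere by (subst disc_norm_cmult) (auto simp: unit_sphere_def)
    ultimately have "disc_norm (\<lambda>i. y i + - 1 * disc_point 1 0 i) \<le> 2"
      using disc_norm_add_le[of y "\<lambda>i. - 1 * disc_point 1 0 i"]
        bounded_range_cmult[of "disc_point 1 0" "- 1"] by simp
    then show "\<alpha> \<le> 2 + \<epsilon>"
      using y(2) by simp
  qed
qed

section \<open>The Daugavet constant\<close>

text \<open>Strong exposure with explicit constants. Since \<open>c = 1 - \<tau> < 1\<close>, the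
  functional undervalues the sup-norm part of \<open>y\<close>, which must then be small; the disc
  part must be close to \<open>(c, s)\<close>, itself close to \<open>(1, 0)\<close>.\<close>

lemma slice_near_disc_point:
  fixes \<tau> s :: real
  assumes \<tau>: "0 < \<tau>" "\<tau> \<le> 1" and cs: "(1 - \<tau>)\<^sup>2 + s\<^sup>2 = 1"
    and y: "y \<in> slice disc_module disc_norm (disc_functional (1 - \<tau>) s) (\<tau>\<^sup>2 / 2)"
  shows "disc_norm (y \<ominus>\<^bsub>disc_module\<^esub> disc_point 1 0) \<le> \<tau> + sqrt (18 * \<tau>)"
proof -
  define \<delta> where "\<delta> = \<tau>\<^sup>2 / 2"
  define c where "c = 1 - \<tau>"
  have "0 < \<delta>"
    using \<tau> by (simp add: \<delta>_def)
  have "\<tau>\<^sup>2 \<le> \<tau>"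
    using \<tau> by (simp add: power2_eq_square mult_left_le)
  then have "\<delta> \<le> \<tau> / 2"
    by (simp add: \<delta>_def)
  have "\<delta>\<^sup>2 \<le> \<delta>"
    using \<open>0 < \<delta>\<close> \<open>\<delta> \<le> \<tau> / 2\<close> \<tau> by (simp add: power2_eq_square mult_left_le)
  have y_bdd: "bounded (range y)" and y_norm: "disc_norm y < 1 + \<delta>"
    and fy: "1 - \<delta> < c * y 1 + s * y 0"
    using y \<open>0 < \<delta>\<close> unfolding slice_def unit_ball_def disc_functional_def c_def \<delta>_def[symmetric]
    by auto
  obtain a u where u: "\<And>i. \<bar>y (Suc i) - a\<bar> \<le> u"
    and sum: "u + sqrt (a\<^sup>2 + (y 0)\<^sup>2) < 1 + \<delta>"
    using disc_norm_decomp[OF y_bdd y_norm] by blast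
  define r where "r = sqrt (a\<^sup>2 + (y 0)\<^sup>2)"
  define q where "q = c * a + s * y 0"
  have "0 \<le> u"
    using u[of 0] by linarith
  have "0 \<le> r"
    by (simp add: r_def)
  have "q \<le> r"
    using inner_le_sqrt[OF cs, of a "y 0"] by (simp add: q_def c_def r_def)
  have "c * (y 1 - a) \<le> c * u"
    using u[of 0] \<tau> by (intro mult_left_mono) (auto simp: c_def)
  then have q: "1 - \<delta> < c * u + q"
    using fy by (simp add: q_def algebra_simps)
  \<comment> \<open>Combining \<open>1 - \<delta> < c * u + r\<close> with
    \<open>u + r < 1 + \<delta>\<close> gives \<open>(1 - c) * u < 2 * \<delta>\<close>; the slice
    width was chosen so that \<open>2 * \<delta> = \<tau>\<^sup>2\<close>.\<close>
  have "\<tau> * u < \<tau> * \<tau>"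
    using q \<open>q \<le> r\<close> sum by (simp add: c_def \<delta>_def r_def power2_eq_square algebra_simps)
  then have "u < \<tau>"
    using \<tau> by simp
  have "c * u \<le> 1 * u"
    using \<tau> \<open>0 \<le> u\<close> by (intro mult_right_mono) (auto simp: c_def)
  then have "1 - \<delta> - \<tau> < q"
    using q \<open>u < \<tau>\<close> by linarith
  have "r\<^sup>2 \<le> (1 + \<delta>)\<^sup>2"
    using sum \<open>0 \<le> u\<close> \<open>0 \<le> r\<close> by (intro power_mono) (auto simp: r_def)
  then have r2: "r\<^sup>2 \<le> 1 + 3 * \<delta>"
    using \<open>\<delta>\<^sup>2 \<le> \<delta>\<close> by (simp add: power2_eq_square algebra_simps)
  have "r\<^sup>2 = a\<^sup>2 + (y 0)\<^sup>2"
    by (simp add: r_def)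
  then have "(a - c)\<^sup>2 + (y 0 - s)\<^sup>2 = r\<^sup>2 + (c\<^sup>2 + s\<^sup>2) - 2 * q"
    by (simp add: q_def power2_eq_square algebra_simps)
  \<comment> \<open>The estimates give \<open>5 * \<delta> + 2 * \<tau>\<close>, which leaves
    room.\<close>
  also have "\<dots> \<le> 7 * \<tau>"
    using r2 cs \<open>1 - \<delta> - \<tau> < q\<close> \<open>\<delta> \<le> \<tau> / 2\<close> \<tau> unfolding c_def by linarith
  finally have near: "(a - c)\<^sup>2 + (y 0 - s)\<^sup>2 \<le> 7 * \<tau>" .
  have "(c - 1)\<^sup>2 + s\<^sup>2 = 2 * \<tau>"
    using cs by (simp add: c_def power2_eq_square algebra_simps)
  \<comment> \<open>The inequality \<open>(p + q)\<^sup>2 \<le> 2 * (p\<^sup>2 + q\<^sup>2)\<close>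
    in each coordinate; the total is \<open>2 * (7 * \<tau> + 2 * \<tau>)\<close>.\<close>
  moreover have "(a - 1)\<^sup>2 \<le> 2 * ((a - c)\<^sup>2 + (c - 1)\<^sup>2)" "(y 0)\<^sup>2 \<le> 2 * ((y 0 - s)\<^sup>2 + s\<^sup>2)"
    using zero_le_power2[of "(a - c) - (c - 1)"] zero_le_power2[of "(y 0 - s) - s"]
    by (simp_all add: power2_eq_square algebra_simps)
  ultimately have dist: "(a - 1)\<^sup>2 + (y 0)\<^sup>2 \<le> 18 * \<tau>"
    using near by argo
  \<comment> \<open>Subtracting \<open>x\<close> shifts \<open>a\<close> to \<open>a - 1\<close> and
    keeps \<open>u\<close>.\<close>
  have "disc_norm (\<lambda>i. y i - disc_point 1 0 i) \<le> u + sqrt ((a - 1)\<^sup>2 + (y 0 - disc_point 1 0 0)\<^sup>2)"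
    using u by (intro disc_norm_le) (simp add: disc_point_def)
  also have "\<dots> \<le> \<tau> + sqrt (18 * \<tau>)"
    using \<open>u < \<tau>\<close> dist by (intro add_mono real_sqrt_le_mono) (auto simp: disc_point_def)
  finally show ?thesis
    by (simp add: minus_disc_module)
qed

text \<open>Nonempty slices put \<open>0\<close> into the set; a positive \<open>\<alpha>\<close> is
  refuted with \<open>\<epsilon> = \<alpha> / 2\<close> by a thin slice near
  \<open>x\<close>.\<close>

lemma daugavet_const_disc: "daugavet_const disc_module disc_norm (disc_point 1 0) = 0"
  unfolding daugavet_const_def
proof (rule cSup_eq_maximum)
  interpret normed_module disc_module disc_norm
    by (rule normed_module_disc)
  have nonneg: "0 \<le> disc_norm (y \<ominus>\<^bsub>disc_module\<^esub> disc_point 1 0)"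
    if "y \<in> slice disc_module disc_norm f \<delta>" for y f \<delta>
    using that abs_le_disc_norm[OF bounded_minus_comp[of y UNIV "disc_point 1 0"], of 0]
    by (auto simp: slice_def unit_ball_def minus_disc_module)
  have "\<exists>y\<in>slice disc_module disc_norm f \<delta>. disc_norm (y \<ominus>\<^bsub>disc_module\<^esub> disc_point 1 0) > 0 - \<epsilon>"
    if "\<epsilon> > 0" "\<delta> > 0" "f \<in> dual_sphere disc_module disc_norm" for \<epsilon> \<delta> f
    using slice_nonempty[OF that(3,2)] nonneg \<open>\<epsilon> > 0\<close> by fastforce
  then show "0 \<in> {\<alpha>. \<alpha> \<ge> 0 \<and> (\<forall>\<epsilon>>0. \<forall>\<delta>>0. \<forall>f\<in>dual_sphere disc_module disc_norm.
    \<exists>y\<in>slice disc_module disc_norm f \<delta>. disc_norm (y \<ominus>\<^bsub>disc_module\<^esub> disc_point 1 0) > \<alpha> - \<epsilon>)}"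
    by blast
next
  fix \<alpha> assume \<alpha>: "\<alpha> \<in> {\<alpha>. \<alpha> \<ge> 0 \<and> (\<forall>\<epsilon>>0. \<forall>\<delta>>0. \<forall>f\<in>dual_sphere disc_module disc_norm.
    \<exists>y\<in>slice disc_module disc_norm f \<delta>. disc_norm (y \<ominus>\<^bsub>disc_module\<^esub> disc_point 1 0) > \<alpha> - \<epsilon>)}"
  show "\<alpha> \<le> 0"
  proof (rule ccontr)
    assume "\<not> \<alpha> \<le> 0"
    \<comment> \<open>With \<open>\<tau> = t\<^sup>2 / 18\<close> the root
      \<open>sqrt (18 * \<tau>)\<close> is \<open>t\<close>, and \<open>\<tau> \<le> t\<close>, so
      the slice lies within \<open>2 * t \<le> \<alpha> / 2\<close> of \<open>x\<close>.\<close>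
    define t where "t = min 1 (\<alpha> / 4)"
    define \<tau> where "\<tau> = t\<^sup>2 / 18"
    have t: "0 < t" "t \<le> 1" "t \<le> \<alpha> / 4"
      using \<open>\<not> \<alpha> \<le> 0\<close> by (auto simp: t_def)
    then have "t\<^sup>2 \<le> t"
      by (simp add: power2_eq_square mult_left_le)
    then have \<tau>: "0 < \<tau>" "\<tau> \<le> 1" "\<tau> \<le> t"
      using t by (auto simp: \<tau>_def)
    define s where "s = sqrt (1 - (1 - \<tau>)\<^sup>2)"
    have cs: "(1 - \<tau>)\<^sup>2 + s\<^sup>2 = 1"
      using \<tau> by (simp add: s_def power_le_one)
    have "disc_functional (1 - \<tau>) s \<in> dual_sphere disc_module disc_norm"
      using disc_functional_in_dual_sphere[OF cs] \<tau> by simp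
    moreover have "0 < \<tau>\<^sup>2 / 2" "0 < \<alpha> / 2"
      using \<tau> \<open>\<not> \<alpha> \<le> 0\<close> by auto
    ultimately obtain y where
      "y \<in> slice disc_module disc_norm (disc_functional (1 - \<tau>) s) (\<tau>\<^sup>2 / 2)"
      "disc_norm (y \<ominus>\<^bsub>disc_module\<^esub> disc_point 1 0) > \<alpha> - \<alpha> / 2"
      using \<alpha> by blast
    then have "\<alpha> / 2 < \<tau> + sqrt (18 * \<tau>)"
      using slice_near_disc_point[OF \<tau>(1,2) cs] by fastforce
    moreover have "sqrt (18 * \<tau>) = t"
      using t by (simp add: \<tau>_def)
    ultimately show False
      using \<tau> t by linarith
  qed
qed

theorem theorem3p14:
  shows "\<exists>(V :: (real, nat \<Rightarrow> real) module) (N :: (nat \<Rightarrow> real) \<Rightarrow> real) x.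
    banach_module V N \<and> x \<in> unit_sphere V N \<and>
    delta_const V N x = 2 \<and> daugavet_const V N x = 0"
  using banach_module_disc disc_point_in_unit_sphere delta_const_disc daugavet_const_disc
  by blast

end
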